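(* Let $X\subset\mathbb{R}^n$ be compact, let $B\in\mathbb{R}^{n\times n}$ be symmetric positive semidefinite of rank $d>0$, set $S=B^{1/2}X\subset\operatorname{range}B$, and suppose that for some $s_0\in\operatorname{range}B$ and $0<r_-\le r_+$, $$s_0+r_-\mathbb{B}_d\subset S\subset s_0+r_+\mathbb{B}_d ,$$ where $\mathbb{B}_d$ is the unit ball of the $d$-dimensional Euclidean space $\operatorname{range}B$. For $\epsilon>0$, let $m_\epsilon$ be the minimum number of tangent supports needed for uniform approximation of $g_B(x)=\tfrac12x^\top Bx$ on $X$ within $\epsilon$, and set $\delta_\epsilon=\sqrt{2\epsilon}$. If $\delta_\epsilon<r_-$, then $$\Bigl(\frac{r_-}{\delta_\epsilon}\Bigr)^d\le m_\epsilon\le\Bigl(1+\frac{2r_+}{\delta_\epsilon}\Bigr)^d .$$ In particular, $m_\epsilon=\Theta(\epsilon^{-d/2})$ as $\epsilon\downarrow0$.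
   Context: $B^{1/2}$ is the positive semidefinite square root of $B$; balls are closed. A set of $m$ tangent supports is given by points $a_1,\dots,a_m\in X$, with model $g_m(x)=\max_{1\le i\le m}\{g_B(a_i)+\langle Ba_i,x-a_i\rangle\}$; it approximates $g_B$ uniformly on $X$ within $\epsilon$ if $\sup_{x\in X}(g_B(x)-g_m(x))\le\epsilon$. Thus $m_\epsilon$ is the smallest $m$ for which such points $a_1,\dots,a_m\in X$ exist. *)

theory Defs
  imports "HOL-Analysis.Analysis" "HOL-Library.Landau_Symbols"
begin

definition sym_psd :: "real^'n^'n \<Rightarrow> bool" where
  "sym_psd B \<longleftrightarrow> transpose B = B \<and> (\<forall>x. 0 \<le> x \<bullet> (B *v x))"

definition psd_sqrt :: "real^'n^'n \<Rightarrow> real^'n^'n" where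
  "psd_sqrt B = (THE R. sym_psd R \<and> R ** R = B)"

definition range_unit_ball :: "real^'n^'n \<Rightarrow> (real^'n) set" where
  "range_unit_ball B = cball 0 1 \<inter> range ((*v) B)"

definition quad_form :: "real^'n^'n \<Rightarrow> real^'n \<Rightarrow> real" where
  "quad_form B x = 1/2 * (x \<bullet> (B *v x))"

definition tangent_model :: "real^'n^'n \<Rightarrow> nat \<Rightarrow> (nat \<Rightarrow> real^'n) \<Rightarrow> real^'n \<Rightarrow> real" where
  "tangent_model B m a x =
     Max ((\<lambda>i. quad_form B (a i) + (B *v a i) \<bullet> (x - a i)) ` {1..m})"

(* m = 0 is excluded because the maximum of an empty family of supports is meaningless. The
   real-valued supremum is the intended one whenever X is compact and nonempty. *)
definition approximable :: "(real^'n) set \<Rightarrow> real^'n^'n \<Rightarrow> real \<Rightarrow> nat \<Rightarrow> bool" where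
  "approximable X B \<epsilon> m \<longleftrightarrow> 1 \<le> m \<and>
     (\<exists>a. (\<forall>i\<in>{1..m}. a i \<in> X) \<and>
          (SUP x\<in>X. quad_form B x - tangent_model B m a x) \<le> \<epsilon>)"

(* Unspecified if no m works, so results about it should also assert that some m works. *)
definition min_supports :: "(real^'n) set \<Rightarrow> real^'n^'n \<Rightarrow> real \<Rightarrow> nat" where
  "min_supports X B \<epsilon> = (LEAST m. approximable X B \<epsilon> m)"

end

theory Submission
  imports Defs
begin

text \<open>The gap between the quadratic and its tangent at \<open>a\<close> is \<open>1/2 |R x - R a|\<^sup>2\<close> with
  \<open>R = psd_sqrt B\<close>, so \<open>m\<close> supports achieve accuracy \<open>\<epsilon>\<close> exactly when \<open>S\<close> is covered by \<open>m\<close> balls of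
  radius \<open>sqrt (2 * \<epsilon>)\<close> with centres in \<open>S\<close>. Volume comparison in the \<open>d\<close>-dimensional range of \<open>B\<close>
  then gives the lower bound, and a maximal separated subset of \<open>S\<close> gives the upper bound.\<close>

subsection \<open>Orthonormal eigenbases and the positive semidefinite square root\<close>

definition self_adjoint :: "('a::real_inner \<Rightarrow> 'a) \<Rightarrow> bool" where
  "self_adjoint f \<longleftrightarrow> linear f \<and> (\<forall>x y. f x \<bullet> y = x \<bullet> f y)"

text \<open>A maximiser \<open>v\<close> of the Rayleigh quotient over the compact unit sphere of
  \<open>V\<close> is an eigenvector: otherwise moving \<open>v\<close> along the residual
  \<open>f v - l v\<close>, which stays in \<open>V\<close>, would increase the quotient.\<close>

lemma self_adjoint_eigenvector:
  fixes f :: "'a::euclidean_space \<Rightarrow> 'a"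
  assumes f: "self_adjoint f" and V: "subspace V" "f ` V \<subseteq> V" "V \<noteq> {0}"
  obtains v l where "v \<in> V" "norm v = 1" "f v = l *\<^sub>R v"
proof -
  have lin: "linear f" and adj: "f x \<bullet> y = x \<bullet> f y" for x y
    using f by (auto simp: self_adjoint_def)
  let ?K = "sphere 0 1 \<inter> V"
  obtain u where u: "u \<in> V" "u \<noteq> 0"
    using V subspace_0 by blast
  then have "u /\<^sub>R norm u \<in> ?K"
    using V(1) by (simp add: subspace_scale)
  then have "?K \<noteq> {}" by blast
  moreover have "compact ?K"
    using V(1) by (simp add: closed_subspace compact_Int_closed)
  moreover have "continuous_on ?K (\<lambda>x. x \<bullet> f x)"
    by (intro continuous_intros linear_continuous_on) (simp add: lin linear_conv_bounded_linear[symmetric])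
  ultimately obtain v where v: "v \<in> ?K" and max: "\<And>x. x \<in> ?K \<Longrightarrow> x \<bullet> f x \<le> v \<bullet> f v"
    using continuous_attains_sup[of ?K "\<lambda>x. x \<bullet> f x"] by blast
  define l where "l = v \<bullet> f v"
  have vv: "v \<bullet> v = 1" using v by (simp add: dot_square_norm)
  have le: "x \<bullet> f x \<le> l * (x \<bullet> x)" if "x \<in> V" for x
  proof (cases "x = 0")
    case False
    then have "x /\<^sub>R norm x \<in> ?K" using V(1) that by (simp add: subspace_scale)
    from max[OF this] have "(x \<bullet> f x) / (norm x)\<^sup>2 \<le> l"
      using lin by (simp add: l_def linear_scale divide_inverse power2_eq_square mult.commute mult.left_commute)
    then show ?thesis using False by (simp add: divide_le_eq dot_square_norm)
  qed simp
  define w where "w = f v - l *\<^sub>R v"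
  have "w \<in> V" using v V by (auto simp: w_def subspace_diff subspace_scale)
  define q where "q = l * (w \<bullet> w) - w \<bullet> f w"
  have q: "0 \<le> q" using le[OF \<open>w \<in> V\<close>] by (simp add: q_def)
  have "w \<bullet> f v = w \<bullet> w + l * (w \<bullet> v)"
    by (simp add: w_def inner_diff_left inner_diff_right algebra_simps)
  then have ww: "f v \<bullet> w - l * (v \<bullet> w) = w \<bullet> w" by (simp add: inner_commute)
  \<comment> \<open>Maximality applied to \<open>v + t *\<^sub>R w\<close>: the constant terms
    cancel, the term linear in \<open>t\<close> is \<open>2 * t * (w \<bullet> w)\<close>, and
    \<open>q\<close> collects the quadratic ones. For small positive \<open>t\<close> this forces
    \<open>w = 0\<close>.\<close>
  have quad: "2 * t * (w \<bullet> w) \<le> t\<^sup>2 * q" for t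
  proof -
    have "v + t *\<^sub>R w \<in> V" using v V \<open>w \<in> V\<close> by (simp add: subspace_add subspace_scale)
    moreover have "w \<bullet> f v = f v \<bullet> w" "v \<bullet> f w = f v \<bullet> w"
      by (simp_all only: inner_commute[of w] adj)
    then have "(v + t *\<^sub>R w) \<bullet> f (v + t *\<^sub>R w) = l + 2 * t * (f v \<bullet> w) + t\<^sup>2 * (w \<bullet> f w)"
      using lin by (simp add: linear_add linear_scale inner_add_left inner_add_right l_def power2_eq_square algebra_simps)
    moreover have "(v + t *\<^sub>R w) \<bullet> (v + t *\<^sub>R w) = 1 + 2 * t * (v \<bullet> w) + t\<^sup>2 * (w \<bullet> w)"
      by (simp add: inner_add_left inner_add_right vv power2_eq_square inner_commute[of w v] algebra_simps)
    ultimately have "l + 2 * t * (f v \<bullet> w) + t\<^sup>2 * (w \<bullet> f w) \<le> l * (1 + 2 * t * (v \<bullet> w) + t\<^sup>2 * (w \<bullet> w))"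
      using le by metis
    then show ?thesis by (simp add: q_def ww[symmetric] algebra_simps)
  qed
  have "w \<bullet> w \<le> 0"
  proof (rule ccontr)
    assume "\<not> w \<bullet> w \<le> 0"
    then have ww: "0 < w \<bullet> w" by linarith
    \<comment> \<open>The denominator \<open>q + 1\<close> is positive even when
      \<open>q = 0\<close>, and this \<open>t\<close> gives
      \<open>t * q < 2 * (w \<bullet> w)\<close>, against \<open>quad\<close>.\<close>
    define t where "t = (w \<bullet> w) / (q + 1)"
    have t: "0 < t" using ww q by (simp add: t_def)
    have "t * q = w \<bullet> w - t" using q by (simp add: t_def field_simps)
    then have "t * q < w \<bullet> w * 2" using t ww by linarith
    then have "t * (t * q) < t * (w \<bullet> w * 2)" using t by simp
    then show False using quad[of t] by (simp add: power2_eq_square mult_ac)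
  qed
  then have "w = 0" by (metis inner_eq_zero_iff inner_ge_zero order_antisym)
  then show thesis using that[of v l] v by (simp add: w_def)
qed

text \<open>Induction on the dimension: split off a unit eigenvector \<open>v\<close>. Its
  orthogonal complement in \<open>V\<close> has smaller dimension and is again invariant, since
  \<open>v \<bullet> f x = f v \<bullet> x = l * (v \<bullet> x)\<close>.\<close>

lemma self_adjoint_orthonormal_eigenbasis:
  fixes f :: "'a::euclidean_space \<Rightarrow> 'a"
  assumes f: "self_adjoint f" and "subspace V" "f ` V \<subseteq> V"
  obtains E l where "finite E" "pairwise orthogonal E" "span E = V"
    "\<And>e. e \<in> E \<Longrightarrow> norm e = 1" "\<And>e. e \<in> E \<Longrightarrow> f e = l e *\<^sub>R e"
proof -
  have lin: "linear f" and adj: "f x \<bullet> y = x \<bullet> f y" for x y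
    using f by (auto simp: self_adjoint_def)
  have "\<exists>E. finite E \<and> pairwise orthogonal E \<and> span E = V \<and> (\<forall>e\<in>E. norm e = 1 \<and> (\<exists>l. f e = l *\<^sub>R e))"
    using assms(2,3)
  proof (induction "dim V" arbitrary: V rule: less_induct)
    case less
    show ?case
    proof (cases "V = {0}")
      case True
      then show ?thesis by (intro exI[of _ "{}"]) auto
    next
      case False
      then obtain v l where v: "v \<in> V" "norm v = 1" "f v = l *\<^sub>R v"
        using self_adjoint_eigenvector[OF f less.prems] by blast
      have vv: "v \<bullet> v = 1" using v by (simp add: dot_square_norm)
      let ?W = "{x \<in> V. v \<bullet> x = 0}"
      have W: "subspace ?W"
        using less.prems(1) by (auto simp: subspace_def inner_simps)
      have "v \<notin> ?W" using vv by simp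
      then have "?W \<subset> V" using v by blast
      then have "dim ?W < dim V"
        by (intro dim_psubset) (metis W less.prems(1) span_eq_iff)
      moreover have "f ` ?W \<subseteq> ?W"
      proof clarify
        fix x assume x: "x \<in> V" "v \<bullet> x = 0"
        then show "f x \<in> V \<and> v \<bullet> f x = 0"
          using less.prems(2) v(3) adj[of v x] by auto
      qed
      ultimately obtain E where E: "finite E" "pairwise orthogonal E" "span E = ?W"
        "\<forall>e\<in>E. norm e = 1 \<and> (\<exists>l. f e = l *\<^sub>R e)"
        using less.hyps[OF _ W] by blast
      have EW: "E \<subseteq> ?W" using E(3) span_superset by blast
      have "pairwise orthogonal (insert v E)"
        using E(2) EW by (auto simp: pairwise_insert orthogonal_def inner_commute)
      moreover have "span (insert v E) = V"
      proof
        show "span (insert v E) \<subseteq> V"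
          using EW v(1) less.prems(1) by (intro span_minimal) auto
        show "V \<subseteq> span (insert v E)"
        proof
          fix x assume "x \<in> V"
          then have "x - (v \<bullet> x) *\<^sub>R v \<in> span E"
            using v(1) vv less.prems(1)
            by (simp add: E(3) inner_diff_right subspace_diff subspace_scale)
          then show "x \<in> span (insert v E)"
            unfolding span_insert by blast
        qed
      qed
      ultimately show ?thesis
        using E v by (intro exI[of _ "insert v E"]) auto
    qed
  qed
  then show thesis using that by metis
qed

section \<open>Existence and uniqueness of the square root\<close>

lemma sym_psd_self_adjoint: "sym_psd A \<Longrightarrow> self_adjoint ((*v) A)"
  unfolding sym_psd_def self_adjoint_def
  by (metis dot_lmul_matrix matrix_vector_mul_linear transpose_matrix_vector)

text \<open>Allows the root to be built as a linear map and turned into a matrix only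
  afterwards.\<close>

lemma sym_psdI:
  fixes f :: "real^'n \<Rightarrow> real^'n"
  assumes "self_adjoint f" "\<And>x. 0 \<le> x \<bullet> f x"
  shows "sym_psd (matrix f)"
proof -
  have f: "matrix f *v x = f x" for x
    using assms(1) by (simp add: self_adjoint_def matrix_works)
  have "transpose (matrix f) *v x = matrix f *v x" for x
  proof (rule vector_eq_rdot[THEN iffD1], rule allI)
    fix y
    show "(transpose (matrix f) *v x) \<bullet> y = (matrix f *v x) \<bullet> y"
      using assms(1) by (simp add: dot_lmul_matrix[symmetric] f self_adjoint_def transpose_matrix_vector dot_lmul_matrix)
  qed
  then show ?thesis
    using assms(2) by (simp add: sym_psd_def f matrix_eq)
qed

text \<open>In an orthonormal eigenbasis of \<open>A\<close> replace every eigenvalue, which is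
  nonnegative, by its square root. The square of the resulting map agrees with \<open>A\<close> on
  the basis, hence everywhere.\<close>

lemma sym_psd_root_exists:
  assumes "sym_psd A"
  obtains R where "sym_psd R" "R ** R = A"
proof -
  obtain E l where E: "finite E" "pairwise orthogonal E" "span E = UNIV"
    "\<And>e. e \<in> E \<Longrightarrow> norm e = 1" "\<And>e. e \<in> E \<Longrightarrow> A *v e = l e *\<^sub>R e"
    by (rule self_adjoint_orthonormal_eigenbasis[OF sym_psd_self_adjoint[OF assms] subspace_UNIV]) auto
  have l: "0 \<le> l e" if "e \<in> E" for e
    using assms E(4,5)[OF that] by (simp add: sym_psd_def dot_square_norm) (metis inner_scaleR_right dot_square_norm power_one mult.right_neutral)
  define f where "f x = (\<Sum>e\<in>E. (sqrt (l e) * (x \<bullet> e)) *\<^sub>R e)" for x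
  have "linear f"
    by (rule linearI) (simp_all add: f_def inner_simps algebra_simps sum.distrib scaleR_sum_right)
  moreover have "f x \<bullet> y = x \<bullet> f y" for x y
    by (simp add: f_def inner_sum_left inner_sum_right inner_commute mult_ac)
  ultimately have adj: "self_adjoint f" by (simp add: self_adjoint_def)
  have psd: "0 \<le> x \<bullet> f x" for x
    using l by (simp add: f_def inner_sum_right mult.assoc sum_nonneg)
  have fe: "f e = sqrt (l e) *\<^sub>R e" if "e \<in> E" for e
  proof -
    have "f e = (\<Sum>e'\<in>E. if e' = e then sqrt (l e) *\<^sub>R e else 0)"
      unfolding f_def using E(2,4) that
      by (intro sum.cong) (auto simp: pairwise_def orthogonal_def dot_square_norm)
    then show ?thesis using E(1) that by simp
  qed
  have "matrix f ** matrix f *v x = A *v x" for x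
  proof (rule linear_eq_on_span[of "(*v) (matrix f ** matrix f)" "(*v) A" E])
    fix e assume "e \<in> E"
    then show "matrix f ** matrix f *v e = A *v e"
      using adj l E(5) by (simp add: self_adjoint_def matrix_vector_mul_assoc[symmetric] matrix_works fe linear_scale)
  qed (auto simp: E(3))
  then show thesis
    using that[of "matrix f"] sym_psdI[OF adj psd] by (simp add: matrix_eq)
qed

text \<open>It suffices to compare the two roots on an eigenbasis of \<open>T\<close>. If
  \<open>T *v e = t *\<^sub>R e\<close>, then \<open>R\<close> applied twice to \<open>e\<close>
  gives \<open>t\<^sup>2 *\<^sub>R e\<close>, and semidefiniteness of \<open>R\<close> selects the
  nonnegative root \<open>t\<close>.\<close>

lemma sym_psd_root_unique:
  assumes R: "sym_psd R" and T: "sym_psd T" and eq: "R ** R = T ** T"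
  shows "R = T"
proof -
  obtain E t where E: "finite E" "span E = UNIV"
    "\<And>e. e \<in> E \<Longrightarrow> norm e = 1" "\<And>e. e \<in> E \<Longrightarrow> T *v e = t e *\<^sub>R e"
    by (rule self_adjoint_orthonormal_eigenbasis[OF sym_psd_self_adjoint[OF T] subspace_UNIV]) auto
  have adj: "(R *v x) \<bullet> y = x \<bullet> (R *v y)" for x y
    using sym_psd_self_adjoint[OF R] by (simp add: self_adjoint_def)
  have "R *v e = T *v e" if "e \<in> E" for e
  proof -
    have e: "T *v e = t e *\<^sub>R e" "e \<bullet> e = 1"
      using E that by (auto simp: dot_square_norm)
    have t: "0 \<le> t e"
      using T e by (metis inner_scaleR_right mult.right_neutral sym_psd_def)
    have RR: "R *v (R *v e) = (t e)\<^sup>2 *\<^sub>R e"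
      using e by (simp add: matrix_vector_mul_assoc eq power2_eq_square)
        (simp add: matrix_vector_mul_assoc[symmetric] matrix_vector_mult_scaleR)
    show ?thesis
    proof (cases "t e = 0")
      case True
      \<comment> \<open>By self-adjointness the squared norm of \<open>R *v e\<close> is
        \<open>e \<bullet> (R *v (R *v e))\<close>, which vanishes.\<close>
      then have "(R *v e) \<bullet> (R *v e) = 0"
        using RR by (simp add: adj)
      then show ?thesis using True e by simp
    next
      case False
      txt \<open>\<open>(R + t) (R - t) e = 0\<close>, and \<open>R + t\<close> is positive definite.\<close>
      define d where "d = R *v e - t e *\<^sub>R e"
      have "R *v d = - t e *\<^sub>R d"
        using RR by (simp add: d_def matrix_vector_mult_diff_distrib matrix_vector_mult_scaleR
            power2_eq_square algebra_simps)
      then have "d \<bullet> (R *v d) = - t e * (d \<bullet> d)" by simp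
      moreover have "0 \<le> d \<bullet> (R *v d)" using R by (simp add: sym_psd_def)
      ultimately have "t e * (d \<bullet> d) \<le> 0" by simp
      then have "d \<bullet> d \<le> 0" using t False by (simp add: mult_le_0_iff)
      then have "d = 0" by (metis inner_eq_zero_iff inner_ge_zero order_antisym)
      then show ?thesis using e by (simp add: d_def)
    qed
  qed
  then have "R *v x = T *v x" for x
    using linear_eq_on_span[of "(*v) R" "(*v) T" E x] E(2) by auto
  then show ?thesis by (simp add: matrix_eq)
qed

lemma psd_sqrt:
  assumes "sym_psd A"
  shows "sym_psd (psd_sqrt A)" "psd_sqrt A ** psd_sqrt A = A"
proof -
  have "\<exists>!R. sym_psd R \<and> R ** R = A"
    using sym_psd_root_exists[OF assms] sym_psd_root_unique by metis
  from theI'[OF this] show "sym_psd (psd_sqrt A)" "psd_sqrt A ** psd_sqrt A = A"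
    by (auto simp: psd_sqrt_def)
qed

text \<open>One factor of the root moves across the inner product. Thus the form of \<open>A\<close>
  becomes the Euclidean geometry of the image under the root.\<close>

lemma psd_sqrt_inner:
  assumes "sym_psd A"
  shows "(psd_sqrt A *v x) \<bullet> (psd_sqrt A *v y) = x \<bullet> (A *v y)"
proof -
  have "(psd_sqrt A *v x) \<bullet> (psd_sqrt A *v y) = x \<bullet> (psd_sqrt A *v (psd_sqrt A *v y))"
    using sym_psd_self_adjoint[OF psd_sqrt(1)[OF assms]] by (simp add: self_adjoint_def)
  then show ?thesis by (simp add: matrix_vector_mul_assoc psd_sqrt[OF assms])
qed

subsection \<open>Covering and packing in a subspace\<close>

text \<open>The projection onto the coordinates in \<open>I\<close> keeps the type of the ambient
  space, so that a dimension known only as a number can be modelled by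
  \<open>card I\<close>.\<close>

definition restrict_coords :: "'n set \<Rightarrow> real^'n \<Rightarrow> real^'n" where
  "restrict_coords I x = (\<chi> i. if i \<in> I then x $ i else 0)"

text \<open>Balls in a subspace have measure zero; thickening them by a fixed cube in the complementary
  coordinates restores a volume that scales with the dimension of the subspace.\<close>
definition cylinder :: "'n set \<Rightarrow> real^'n \<Rightarrow> real \<Rightarrow> (real^'n) set" where
  "cylinder I c r = {x. norm (restrict_coords I (x - c)) \<le> r \<and> (\<forall>i. i \<notin> I \<longrightarrow> \<bar>x $ i\<bar> \<le> 1)}"

lemma linear_restrict_coords: "linear (restrict_coords I)"
  by (rule linearI) (auto simp: restrict_coords_def vec_eq_iff)

lemma restrict_coords_ident: "(\<And>i. i \<notin> I \<Longrightarrow> x $ i = 0) \<Longrightarrow> restrict_coords I x = x"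
  by (auto simp: restrict_coords_def vec_eq_iff)

lemma norm_restrict_coords_le: "norm (restrict_coords I x) \<le> norm x"
  by (rule norm_le_componentwise_cart) (simp add: restrict_coords_def)

lemma lmeasurable_cylinder: "cylinder I c r \<in> lmeasurable"
proof -
  have lin: "continuous_on A (\<lambda>x. restrict_coords I (x - c))" for A
    by (intro linear_continuous_on_compose[OF _ linear_restrict_coords] continuous_intros)
  have "closed (cylinder I c r)"
    unfolding cylinder_def imp_conv_disj
    by (intro closed_Collect_conj closed_Collect_all closed_Collect_disj closed_Collect_le
        continuous_intros lin) auto
  moreover have "bounded (cylinder I c r)"
  proof (rule bounded_subset[OF bounded_cbox])
    \<comment> \<open>The half-width serves both kinds of coordinate:
      \<open>\<bar>c $ i\<bar> + r\<close> for those in \<open>I\<close> and \<open>1\<close> for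
      the rest. That \<open>r\<close> is nonnegative follows from the presence of a point
      \<open>x\<close>.\<close>
    show "cylinder I c r \<subseteq> cbox (\<chi> i. - (\<bar>c $ i\<bar> + r + 1)) (\<chi> i. \<bar>c $ i\<bar> + r + 1)"
    proof
      fix x assume x: "x \<in> cylinder I c r"
      have r: "0 \<le> r"
        using x norm_ge_zero order_trans unfolding cylinder_def by blast
      have "\<bar>x $ i\<bar> \<le> \<bar>c $ i\<bar> + r + 1" for i
      proof (cases "i \<in> I")
        case True
        have "\<bar>restrict_coords I (x - c) $ i\<bar> \<le> r"
          using x component_le_norm_cart[of "restrict_coords I (x - c)" i]
          unfolding cylinder_def by auto
        then show ?thesis using True by (simp add: restrict_coords_def)
      next
        case False
        with x have "\<bar>x $ i\<bar> \<le> 1" by (auto simp: cylinder_def)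
        then show ?thesis using r by linarith
      qed
      then show "x \<in> cbox (\<chi> i. - (\<bar>c $ i\<bar> + r + 1)) (\<chi> i. \<bar>c $ i\<bar> + r + 1)"
        by (simp add: mem_box_cart abs_le_iff) (smt (verit))
    qed
  qed
  ultimately show ?thesis
    by (simp add: compact_eq_bounded_closed lmeasurable_compact)
qed

text \<open>The unit cylinder contains the unit ball. Positivity allows its volume to be cancelled
  in the comparisons below.\<close>

lemma measure_cylinder_unit_pos:
  fixes I :: "'n::finite set"
  shows "0 < measure lebesgue (cylinder I 0 1)"
proof -
  have "cball 0 1 \<subseteq> cylinder I (0 :: real^'n) 1"
    using order_trans[OF norm_restrict_coords_le] order_trans[OF component_le_norm_cart]
    by (fastforce simp: cylinder_def)
  then have "measure lebesgue (cball 0 1 :: (real^'n) set) \<le> measure lebesgue (cylinder I (0 :: real^'n) 1)"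
    by (intro measure_mono_fmeasurable lmeasurable_cylinder) auto
  moreover have "0 < measure lebesgue (cball 0 1 :: (real^'n) set)"
    using content_cball_pos[of 1 "0 :: real^'n"] by simp
  ultimately show ?thesis by linarith
qed

text \<open>Stretching the coordinates in \<open>I\<close> by \<open>r\<close> and then translating
  by \<open>restrict_coords I c\<close> carries the unit cylinder onto this one. The determinant is
  \<open>r ^ card I\<close>; the cube in the other coordinates stays fixed, being centred at the
  origin whatever \<open>c\<close> is.\<close>

lemma measure_cylinder:
  fixes I :: "'n::finite set"
  assumes "0 < r"
  shows "measure lebesgue (cylinder I c r) = r ^ card I * measure lebesgue (cylinder I 0 1)"
proof -
  define m where "m i = (if i \<in> I then r else 1)" for i
  define T where "T = (\<lambda>x. \<chi> i. m i * x $ i) ` cylinder I (0::real^'n) 1"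
  have m: "m i \<noteq> 0" for i using assms by (simp add: m_def)
  have res: "restrict_coords I (x - c) = r *\<^sub>R restrict_coords I (\<chi> i. (x - restrict_coords I c) $ i / m i)" for x
    using assms by (auto simp: vec_eq_iff restrict_coords_def m_def)
  have out: "(\<chi> i. (x - restrict_coords I c) $ i / m i) $ j = x $ j" if "j \<notin> I" for x j
    using that by (auto simp: restrict_coords_def m_def)
  have mem: "x \<in> cylinder I c r \<longleftrightarrow> (\<chi> i. (x - restrict_coords I c) $ i / m i) \<in> cylinder I 0 1" for x
    using assms out by (simp add: cylinder_def res pos_le_divide_eq[symmetric] cong: imp_cong)
  have "cylinder I c r = (+) (restrict_coords I c) ` T"
  proof (intro equalityI subsetI)
    fix x assume "x \<in> cylinder I c r"
    then have "(\<chi> i. m i * (\<chi> i. (x - restrict_coords I c) $ i / m i) $ i) \<in> T"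
      unfolding mem T_def by (rule imageI)
    then have "x - restrict_coords I c \<in> T"
      using m by (simp add: minus_vec_def)
    then show "x \<in> (+) (restrict_coords I c) ` T"
      by (rule rev_image_eqI) simp
  next
    fix x assume "x \<in> (+) (restrict_coords I c) ` T"
    then obtain y where y: "y \<in> cylinder I 0 1" "x = restrict_coords I c + (\<chi> i. m i * y $ i)"
      by (auto simp: T_def)
    then have "(\<chi> i. (x - restrict_coords I c) $ i / m i) = y"
      using m by (simp add: vec_eq_iff)
    then show "x \<in> cylinder I c r" using y mem by simp
  qed
  then have "measure lebesgue (cylinder I c r) = measure lebesgue T"
    by (simp add: measure_translation)
  also have "\<dots> = \<bar>prod m UNIV\<bar> * measure lebesgue (cylinder I (0::real^'n) 1)"
    unfolding T_def by (rule measure_stretch) (rule lmeasurable_cylinder)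
  also have "prod m UNIV = r ^ card I"
    by (simp add: m_def prod.If_cases)
  finally show ?thesis using assms by simp
qed

section \<open>Isometric coordinates on a subspace\<close>

lemma dim_coords: "dim {x::real^'n. \<forall>i. i \<notin> I \<longrightarrow> x $ i = 0} = card I"
  using dim_substandard_cart[where 'a = real, of I] by (simp add: dim_vec_eq)

lemma subspace_coords: "subspace {x::real^'n. \<forall>i. i \<notin> I \<longrightarrow> x $ i = 0}"
  by (auto simp: subspace_def)

text \<open>Subspaces of equal dimension are isometric, so \<open>V\<close> can be matched with a
  coordinate subspace. \<open>f\<close> maps \<open>V\<close> onto it preserving norms, and
  \<open>g\<close> is its inverse there; precomposing \<open>g\<close> with
  \<open>restrict_coords I\<close> lets it be used at any point of the ambient space.\<close>

lemma subspace_coordinates: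
  fixes V :: "(real^'n) set"
  assumes "subspace V"
  obtains f g :: "real^'n \<Rightarrow> real^'n" and I where "linear f" "card I = dim V"
    "\<And>x. x \<in> V \<Longrightarrow> norm (f x) = norm x"
    "\<And>x. x \<in> V \<Longrightarrow> restrict_coords I (f x) = f x"
    "\<And>x. g (restrict_coords I x) \<in> V"
    "\<And>x. f (g (restrict_coords I x)) = restrict_coords I x"
proof -
  have "dim V \<le> CARD('n)" using dim_subset_UNIV[of V] by simp
  then obtain I :: "'n set" where I: "card I = dim V"
    by (meson obtain_subset_with_card_n)
  let ?T = "{x::real^'n. \<forall>i. i \<notin> I \<longrightarrow> x $ i = 0}"
  have "dim V = dim ?T" using I by (simp add: dim_coords)
  then obtain f g where
    fg: "linear f" "linear g" "f ` V = ?T" "g ` ?T = V" "\<And>x. x \<in> V \<Longrightarrow> norm (f x) = norm x"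
    "\<And>x. x \<in> ?T \<Longrightarrow> f (g x) = x"
    by (rule isometries_subspaces[OF assms subspace_coords]) blast
  have T: "restrict_coords I x \<in> ?T" for x by (simp add: restrict_coords_def)
  show thesis
  proof (rule that[of f I g])
    show "restrict_coords I (f x) = f x" if "x \<in> V" for x
      using fg(3) that by (intro restrict_coords_ident) blast
  qed (use fg I T in auto)
qed

text \<open>After thickening, the ball of radius \<open>r\<close> becomes a cylinder covered by
  \<open>card C\<close> cylinders of radius \<open>\<delta>\<close>. Their volumes are
  \<open>r ^ dim V\<close> and \<open>\<delta> ^ dim V\<close> times that of the unit
  cylinder.\<close>

lemma covering_number_lower:
  fixes V :: "(real^'n) set"
  assumes V: "subspace V" "C \<subseteq> V" "c \<in> V" and "finite C" and pos: "0 < r" "0 < \<delta>"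
    and cover: "cball c r \<inter> V \<subseteq> (\<Union>p\<in>C. cball p \<delta>)"
  shows "(r / \<delta>) ^ dim V \<le> card C"
proof -
  obtain f g and I :: "'n set" where fg: "linear f" "card I = dim V"
    "\<And>x. x \<in> V \<Longrightarrow> norm (f x) = norm x"
    "\<And>x. x \<in> V \<Longrightarrow> restrict_coords I (f x) = f x"
    "\<And>x. g (restrict_coords I x) \<in> V"
    "\<And>x. f (g (restrict_coords I x)) = restrict_coords I x"
    by (rule subspace_coordinates[OF V(1)]) blast
  \<comment> \<open>Each ambient point \<open>y\<close> is represented in \<open>V\<close> by
    \<open>g (restrict_coords I y)\<close>; the radial condition of a cylinder about
    \<open>f p\<close> is a distance condition on this representative.\<close>
  have dist_eq: "norm (restrict_coords I (y - f p)) = dist p (g (restrict_coords I y))" if "p \<in> V" for y p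
  proof -
    have "restrict_coords I (y - f p) = f (g (restrict_coords I y) - p)"
      using fg that by (simp add: linear_diff linear_restrict_coords)
    then show ?thesis
      using fg that V by (simp add: subspace_diff dist_norm norm_minus_commute)
  qed
  let ?\<mu> = "measure lebesgue (cylinder I (0::real^'n) 1)"
  have "cylinder I (f c) r \<subseteq> (\<Union>p\<in>C. cylinder I (f p) \<delta>)"
  proof
    fix y assume y: "y \<in> cylinder I (f c) r"
    then have "g (restrict_coords I y) \<in> cball c r \<inter> V"
      using fg(5) dist_eq[OF \<open>c \<in> V\<close>] by (auto simp: cylinder_def)
    then obtain p where "p \<in> C" "dist p (g (restrict_coords I y)) \<le> \<delta>"
      using cover by auto
    then show "y \<in> (\<Union>p\<in>C. cylinder I (f p) \<delta>)"
      using y dist_eq V by (auto simp: cylinder_def intro!: bexI[of _ p])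
  qed
  then have "measure lebesgue (cylinder I (f c) r) \<le> measure lebesgue (\<Union>p\<in>C. cylinder I (f p) \<delta>)"
    using \<open>finite C\<close> by (intro measure_mono_fmeasurable fmeasurable.finite_UN) (auto simp: lmeasurable_cylinder fmeasurableD)
  also have "\<dots> \<le> (\<Sum>p\<in>C. measure lebesgue (cylinder I (f p) \<delta>))"
    using \<open>finite C\<close> by (intro measure_UNION_le fmeasurableD lmeasurable_cylinder)
  finally have "r ^ dim V * ?\<mu> \<le> (card C * \<delta> ^ dim V) * ?\<mu>"
    using fg(2) by (simp add: measure_cylinder[OF pos(1)] measure_cylinder[OF pos(2)] mult.assoc)
  then have "r ^ dim V \<le> card C * \<delta> ^ dim V"
    using measure_cylinder_unit_pos[where I = I] by (simp only: mult_le_cancel_right_pos)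
  then show ?thesis using pos by (simp add: power_divide pos_divide_le_eq)
qed

text \<open>Balls of radius \<open>\<delta> / 2\<close> about separated points are disjoint and lie
  in a ball of radius \<open>r + \<delta> / 2\<close>. The ratio of these radii is
  \<open>1 + 2 * r / \<delta>\<close>.\<close>

lemma packing_number_upper:
  fixes V :: "(real^'n) set"
  assumes V: "subspace V" "C \<subseteq> V" "c \<in> V" and "finite C" and pos: "0 < r" "0 < \<delta>"
    and C: "C \<subseteq> cball c r" and sep: "pairwise (\<lambda>p q. \<delta> < dist p q) C"
  shows "card C \<le> (1 + 2 * r / \<delta>) ^ dim V"
proof -
  obtain f and I :: "'n set" where fg: "linear f" "card I = dim V"
    "\<And>x. x \<in> V \<Longrightarrow> norm (f x) = norm x"
    "\<And>x. x \<in> V \<Longrightarrow> restrict_coords I (f x) = f x"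
    by (rule subspace_coordinates[OF V(1)]) blast
  have diff: "norm (restrict_coords I (y - f p) - restrict_coords I (y - f q)) = dist p q"
    if "p \<in> V" "q \<in> V" for y p q
  proof -
    have "restrict_coords I (y - f p) - restrict_coords I (y - f q) = f (q - p)"
      using fg that by (simp add: linear_diff linear_restrict_coords)
    then show ?thesis
      using fg that V by (simp add: subspace_diff dist_norm norm_minus_commute)
  qed
  let ?\<mu> = "measure lebesgue (cylinder I (0::real^'n) 1)"
  \<comment> \<open>The cylinders are closed, so disjointness rests on the separation being
    strict.\<close>
  have disj: "disjoint_family_on (\<lambda>p. cylinder I (f p) (\<delta> / 2)) C"
    unfolding disjoint_family_on_def
  proof (intro ballI impI equals0I)
    fix p q y assume pq: "p \<in> C" "q \<in> C" "p \<noteq> q"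
      and y: "y \<in> cylinder I (f p) (\<delta> / 2) \<inter> cylinder I (f q) (\<delta> / 2)"
    have "dist p q \<le> norm (restrict_coords I (y - f p)) + norm (restrict_coords I (y - f q))"
      using norm_triangle_ineq4 pq V diff by (metis subsetD)
    also have "\<dots> \<le> \<delta>" using y by (auto simp: cylinder_def)
    finally show False using sep pq by (force simp: pairwise_def)
  qed
  have sub: "(\<Union>p\<in>C. cylinder I (f p) (\<delta> / 2)) \<subseteq> cylinder I (f c) (r + \<delta> / 2)"
  proof clarify
    fix p y assume p: "p \<in> C" and y: "y \<in> cylinder I (f p) (\<delta> / 2)"
    have "norm (restrict_coords I (y - f c)) \<le> norm (restrict_coords I (y - f p)) + dist p c"
      using norm_triangle_sub[of "restrict_coords I (y - f c)" "restrict_coords I (y - f p)"]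
        diff[of c p y] p V by (auto simp: dist_commute)
    also have "\<dots> \<le> r + \<delta> / 2"
      using y p C by (force simp: cylinder_def dist_commute)
    finally show "y \<in> cylinder I (f c) (r + \<delta> / 2)" using y by (auto simp: cylinder_def)
  qed
  have "(\<Sum>p\<in>C. measure lebesgue (cylinder I (f p) (\<delta> / 2))) = measure lebesgue (\<Union>p\<in>C. cylinder I (f p) (\<delta> / 2))"
    using \<open>finite C\<close> disj
    by (intro measure_finite_Union[symmetric])
      (auto simp: fmeasurableD fmeasurableD2 lmeasurable_cylinder simp del: emeasure_completion)
  also have "\<dots> \<le> measure lebesgue (cylinder I (f c) (r + \<delta> / 2))"
    using \<open>finite C\<close> by (intro measure_mono_fmeasurable sub lmeasurable_cylinder sets.finite_UN) (auto simp: lmeasurable_cylinder fmeasurableD)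
  finally have "(card C * (\<delta> / 2) ^ dim V) * ?\<mu> \<le> (r + \<delta> / 2) ^ dim V * ?\<mu>"
    using fg(2) measure_cylinder[of "\<delta> / 2" I] measure_cylinder[of "r + \<delta> / 2" I "f c"] pos
    by (simp add: mult.assoc)
  then have "card C * (\<delta> / 2) ^ dim V \<le> (r + \<delta> / 2) ^ dim V"
    using measure_cylinder_unit_pos[where I = I] by (simp only: mult_le_cancel_right_pos)
  moreover have "0 < (\<delta> / 2) ^ dim V"
    using pos by simp
  ultimately have "card C \<le> (r + \<delta> / 2) ^ dim V / (\<delta> / 2) ^ dim V"
    by (simp only: pos_le_divide_eq)
  also have "\<dots> = ((r + \<delta> / 2) / (\<delta> / 2)) ^ dim V"
    by (simp only: power_divide)
  also have "(r + \<delta> / 2) / (\<delta> / 2) = 1 + 2 * r / \<delta>"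
    using pos by (simp add: field_simps)
  finally show ?thesis .
qed

text \<open>A separated subset of \<open>S\<close> of largest cardinality covers \<open>S\<close>:
  an uncovered point could be added to it. Such a subset exists because the packing bound limits all
  these cardinalities.\<close>

lemma covering_number_upper:
  fixes V :: "(real^'n) set"
  assumes V: "subspace V" "S \<subseteq> V" "c \<in> V" and pos: "0 < r" "0 < \<delta>"
    and S: "S \<subseteq> cball c r"
  obtains C where "finite C" "C \<subseteq> S" "S \<subseteq> (\<Union>p\<in>C. cball p \<delta>)"
    "card C \<le> (1 + 2 * r / \<delta>) ^ dim V"
proof -
  let ?sep = "pairwise (\<lambda>p q. \<delta> < dist p q)"
  let ?P = "\<lambda>k. \<exists>C. finite C \<and> C \<subseteq> S \<and> ?sep C \<and> card C = k"
  have bound: "card C \<le> (1 + 2 * r / \<delta>) ^ dim V" if "finite C" "C \<subseteq> S" "?sep C" for C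
    using packing_number_upper[OF V(1) _ V(3) that(1) pos _ that(3)] that(2) V(2) S by blast
  have le: "k \<le> nat \<lfloor>(1 + 2 * r / \<delta>) ^ dim V\<rfloor>" if "?P k" for k
    using that bound by (auto simp: le_nat_floor)
  have "?P 0" by (auto intro!: exI[of _ "{}"])
  then have "?P (Greatest ?P)"
    using le by (rule GreatestI_nat)
  then obtain C where C: "finite C" "C \<subseteq> S" "?sep C" "card C = Greatest ?P"
    by blast
  have "S \<subseteq> (\<Union>p\<in>C. cball p \<delta>)"
  proof (rule ccontr)
    assume "\<not> ?thesis"
    then obtain x where x: "x \<in> S" "\<And>p. p \<in> C \<Longrightarrow> \<delta> < dist p x"
      by (meson UN_I mem_cball not_le subsetI)
    then have "x \<notin> C" using pos by force
    then have "?P (Suc (card C))"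
      using C x by (intro exI[of _ "insert x C"]) (auto simp: pairwise_insert dist_commute)
    then have "Suc (card C) \<le> Greatest ?P"
      using le by (rule Greatest_le_nat)
    then show False using C(4) by simp
  qed
  then show thesis using that C bound by blast
qed

subsection \<open>Tangent models as coverings\<close>

text \<open>Serves to list at most \<open>m\<close> centres as exactly \<open>m\<close> supports:
  invert an injection of \<open>C\<close> into \<open>{1..m}\<close> and send the indices it misses
  to one fixed element.\<close>

lemma ex_surj_from_atLeastAtMost:
  assumes "finite C" "C \<noteq> {}" "card C \<le> m"
  obtains h where "h ` {1..m::nat} = C"
proof -
  obtain f where f: "f ` C \<subseteq> {1..m}" "inj_on f C"
    using card_le_inj[of C "{1..m}"] assms by auto
  obtain c where "c \<in> C" using assms by blast
  have "(\<lambda>i. if i \<in> f ` C then inv_into C f i else c) ` {1..m} = C"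
  proof
    show "C \<subseteq> (\<lambda>i. if i \<in> f ` C then inv_into C f i else c) ` {1..m}"
    proof
      fix x assume "x \<in> C"
      then show "x \<in> (\<lambda>i. if i \<in> f ` C then inv_into C f i else c) ` {1..m}"
        using f by (intro image_eqI[of _ _ "f x"]) auto
    qed
  qed (use \<open>c \<in> C\<close> in \<open>auto intro: inv_into_into\<close>)
  then show thesis by (rule that)
qed

text \<open>Symmetry of \<open>B\<close> merges the cross terms, leaving half the form of
  \<open>B\<close> at \<open>x - a\<close>.\<close>

lemma tangent_gap:
  assumes "sym_psd B"
  shows "quad_form B x - (quad_form B a + (B *v a) \<bullet> (x - a))
    = 1/2 * (dist (psd_sqrt B *v x) (psd_sqrt B *v a))\<^sup>2"
proof -
  have "(B *v a) \<bullet> x = x \<bullet> (B *v a)" "(B *v a) \<bullet> a = a \<bullet> (B *v a)" "a \<bullet> (B *v x) = x \<bullet> (B *v a)"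
    using sym_psd_self_adjoint[OF assms] by (metis inner_commute self_adjoint_def)+
  then show ?thesis
    by (simp add: dist_norm power2_norm_eq_inner inner_diff_left inner_diff_right
        psd_sqrt_inner[OF assms] quad_form_def field_simps)
qed

text \<open>A maximum over a nonempty finite family reaches a level exactly when some member does,
  so accuracy at \<open>x\<close> means that one support point is close to \<open>x\<close> after
  applying the root.\<close>

lemma model_gap_le_iff:
  assumes "sym_psd B" "1 \<le> m" "0 \<le> \<epsilon>"
  shows "quad_form B x - tangent_model B m a x \<le> \<epsilon> \<longleftrightarrow>
    (\<exists>i\<in>{1..m}. dist (psd_sqrt B *v x) (psd_sqrt B *v a i) \<le> sqrt (2 * \<epsilon>))"
proof -
  have "quad_form B x - tangent_model B m a x \<le> \<epsilon> \<longleftrightarrow> quad_form B x - \<epsilon> \<le> tangent_model B m a x"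
    by linarith
  also have "\<dots> \<longleftrightarrow> (\<exists>i\<in>{1..m}. quad_form B x - \<epsilon> \<le> quad_form B (a i) + (B *v a i) \<bullet> (x - a i))"
    using assms(2) unfolding tangent_model_def by (subst Max_ge_iff) auto
  also have "\<dots> \<longleftrightarrow> (\<exists>i\<in>{1..m}. (dist (psd_sqrt B *v x) (psd_sqrt B *v a i))\<^sup>2 \<le> 2 * \<epsilon>)"
  proof (intro bex_cong refl)
    fix i
    show "quad_form B x - \<epsilon> \<le> quad_form B (a i) + (B *v a i) \<bullet> (x - a i) \<longleftrightarrow>
      (dist (psd_sqrt B *v x) (psd_sqrt B *v a i))\<^sup>2 \<le> 2 * \<epsilon>"
      using tangent_gap[OF assms(1), of x "a i"] by linarith
  qed
  also have "\<dots> \<longleftrightarrow> (\<exists>i\<in>{1..m}. dist (psd_sqrt B *v x) (psd_sqrt B *v a i) \<le> sqrt (2 * \<epsilon>))"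
    by (intro bex_cong refl) (metis real_le_rsqrt real_sqrt_le_iff real_sqrt_abs abs_of_nonneg zero_le_dist)
  finally show ?thesis .
qed

lemma approximable_iff_covering:
  fixes X :: "(real^'n) set"
  assumes X: "compact X" "X \<noteq> {}" and B: "sym_psd B" and "0 \<le> \<epsilon>"
  defines "S \<equiv> (\<lambda>x. psd_sqrt B *v x) ` X"
  shows "approximable X B \<epsilon> m \<longleftrightarrow>
    (\<exists>C. finite C \<and> C \<subseteq> S \<and> card C \<le> m \<and> S \<subseteq> (\<Union>p\<in>C. cball p (sqrt (2 * \<epsilon>))))"
proof
  assume "approximable X B \<epsilon> m"
  then obtain a where m: "1 \<le> m" and a: "\<And>i. i \<in> {1..m} \<Longrightarrow> a i \<in> X"
    and sup: "(SUP x\<in>X. quad_form B x - tangent_model B m a x) \<le> \<epsilon>"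
    unfolding approximable_def by blast
  \<comment> \<open>A bound on a real supremum controls the values only if they are bounded above.
    The model dominates its first support, so the gap is at most \<open>?gap1\<close>, which is
    continuous and hence bounded on the compact \<open>X\<close>.\<close>
  let ?gap1 = "\<lambda>x. quad_form B x - (quad_form B (a 1) + (B *v a 1) \<bullet> (x - a 1))"
  have "continuous_on X ?gap1"
    unfolding quad_form_def by (intro continuous_intros matrix_vector_mult_linear_continuous_on)
  then have "bdd_above (?gap1 ` X)"
    using X(1) by (intro bounded_imp_bdd_above compact_imp_bounded compact_continuous_image)
  then obtain K where K: "?gap1 x \<le> K" if "x \<in> X" for x
    unfolding bdd_above_def by blast
  have "quad_form B (a 1) + (B *v a 1) \<bullet> (x - a 1) \<le> tangent_model B m a x" for x
    using m unfolding tangent_model_def by (intro Max_ge) auto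
  then have "bdd_above ((\<lambda>x. quad_form B x - tangent_model B m a x) ` X)"
    using K by (intro bdd_aboveI2[of _ _ K]) (meson diff_left_mono order_trans)
  from cSUP_upper[OF _ this] sup
  have "quad_form B x - tangent_model B m a x \<le> \<epsilon>" if "x \<in> X" for x
    using that by (meson order_trans)
  then have "\<exists>i\<in>{1..m}. dist (psd_sqrt B *v x) (psd_sqrt B *v a i) \<le> sqrt (2 * \<epsilon>)" if "x \<in> X" for x
    using that model_gap_le_iff[OF B m \<open>0 \<le> \<epsilon>\<close>] by blast
  then have "S \<subseteq> (\<Union>p\<in>(\<lambda>i. psd_sqrt B *v a i) ` {1..m}. cball p (sqrt (2 * \<epsilon>)))"
    by (auto simp: S_def dist_commute)
  moreover have "card ((\<lambda>i. psd_sqrt B *v a i) ` {1..m}) \<le> m"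
    using card_image_le[of "{1..m}"] by simp
  ultimately show "\<exists>C. finite C \<and> C \<subseteq> S \<and> card C \<le> m \<and> S \<subseteq> (\<Union>p\<in>C. cball p (sqrt (2 * \<epsilon>)))"
    using a by (intro exI[of _ "(\<lambda>i. psd_sqrt B *v a i) ` {1..m}"]) (auto simp: S_def)
next
  assume "\<exists>C. finite C \<and> C \<subseteq> S \<and> card C \<le> m \<and> S \<subseteq> (\<Union>p\<in>C. cball p (sqrt (2 * \<epsilon>)))"
  then obtain C where C: "finite C" "C \<subseteq> S" "card C \<le> m" "S \<subseteq> (\<Union>p\<in>C. cball p (sqrt (2 * \<epsilon>)))"
    by blast
  have "C \<noteq> {}" using C(4) X(2) by (auto simp: S_def)
  then have m: "1 \<le> m"
    using C(1,3) by (metis One_nat_def Suc_leI card_gt_0_iff order_less_le_trans)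
  obtain h where h: "h ` {1..m} = C"
    by (rule ex_surj_from_atLeastAtMost[OF C(1) \<open>C \<noteq> {}\<close> C(3)])
  \<comment> \<open>The supports are taken at preimages in \<open>X\<close> of the centres, which
    exist because the centres lie in \<open>S\<close>.\<close>
  then have "\<forall>i\<in>{1..m}. \<exists>x\<in>X. h i = psd_sqrt B *v x"
    using C(2) unfolding S_def by blast
  then obtain a where a: "\<And>i. i \<in> {1..m} \<Longrightarrow> a i \<in> X" "\<And>i. i \<in> {1..m} \<Longrightarrow> h i = psd_sqrt B *v a i"
    by metis
  have "\<exists>i\<in>{1..m}. dist (psd_sqrt B *v x) (psd_sqrt B *v a i) \<le> sqrt (2 * \<epsilon>)" if x: "x \<in> X" for x
  proof -
    have "psd_sqrt B *v x \<in> (\<Union>p\<in>h ` {1..m}. cball p (sqrt (2 * \<epsilon>)))"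
      using C(4) x h unfolding S_def by blast
    then obtain i where "i \<in> {1..m}" "dist (h i) (psd_sqrt B *v x) \<le> sqrt (2 * \<epsilon>)"
      by auto
    then show ?thesis using a(2) by (metis dist_commute)
  qed
  then have "quad_form B x - tangent_model B m a x \<le> \<epsilon>" if "x \<in> X" for x
    using that model_gap_le_iff[OF B m \<open>0 \<le> \<epsilon>\<close>] by blast
  then have "(SUP x\<in>X. quad_form B x - tangent_model B m a x) \<le> \<epsilon>"
    by (intro cSUP_least X(2))
  then show "approximable X B \<epsilon> m"
    using m a(1) unfolding approximable_def by blast
qed

lemma scaled_ball_range:
  fixes B :: "real^'n^'n"
  assumes "0 < r" "s0 \<in> range ((*v) B)"
  shows "(\<lambda>u. s0 + r *\<^sub>R u) ` range_unit_ball B = cball s0 r \<inter> range ((*v) B)"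
proof -
  have V: "subspace (range ((*v) B))"
    by (simp add: subspace_UNIV linear_subspace_image)
  show ?thesis
  proof (intro equalityI subsetI)
    fix y assume "y \<in> (\<lambda>u. s0 + r *\<^sub>R u) ` range_unit_ball B"
    then obtain u where u: "y = s0 + r *\<^sub>R u" "norm u \<le> 1" "u \<in> range ((*v) B)"
      unfolding range_unit_ball_def by (force simp only: image_iff Int_iff mem_cball_0 Bex_def)
    then show "y \<in> cball s0 r \<inter> range ((*v) B)"
      using V assms by (simp add: dist_norm subspace_add subspace_scale)
  next
    fix y assume y: "y \<in> cball s0 r \<inter> range ((*v) B)"
    have "(1 / r) *\<^sub>R (y - s0) \<in> range ((*v) B)"
      using V assms y by (intro subspace_scale subspace_diff) auto
    moreover have "norm ((1 / r) *\<^sub>R (y - s0)) \<le> 1"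
      using assms y by (simp add: dist_norm norm_minus_commute)
    ultimately show "y \<in> (\<lambda>u. s0 + r *\<^sub>R u) ` range_unit_ball B"
      using assms by (intro image_eqI[of _ _ "(1 / r) *\<^sub>R (y - s0)"]) (auto simp: range_unit_ball_def)
  qed
qed

section \<open>Order of growth and conclusion\<close>

lemma power_div_sqrt:
  assumes "0 < \<epsilon>"
  shows "(r / sqrt (2 * \<epsilon>)) ^ d = (r / sqrt 2) ^ d * \<epsilon> powr (- (real d / 2))"
proof -
  have "sqrt \<epsilon> ^ d = \<epsilon> powr (real d / 2)"
    using assms by (simp add: powr_half_sqrt[symmetric] powr_realpow[symmetric] powr_powr)
  then show ?thesis
    by (simp add: real_sqrt_mult power_divide power_mult_distrib powr_minus field_simps)
qed

text \<open>The lower bound is already a constant times the required power. In the upper bound, the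
  summand \<open>1\<close> is absorbed into \<open>r' / sqrt (2 * \<epsilon>)\<close> once
  \<open>\<epsilon>\<close> is small, which yields the constant
  \<open>(3 * r' / sqrt 2) ^ d\<close>.\<close>

lemma theta_of_covering_bounds:
  fixes N :: "real \<Rightarrow> real"
  assumes r: "0 < r" "0 < r'"
    and lower: "\<And>\<epsilon>. 0 < \<epsilon> \<Longrightarrow> (r / sqrt (2 * \<epsilon>)) ^ d \<le> N \<epsilon>"
    and upper: "\<And>\<epsilon>. 0 < \<epsilon> \<Longrightarrow> N \<epsilon> \<le> (1 + 2 * r' / sqrt (2 * \<epsilon>)) ^ d"
  shows "N \<in> \<Theta>[at_right 0](\<lambda>\<epsilon>. \<epsilon> powr (- (real d / 2)))"
proof (rule bigthetaI)
  have nonneg: "0 \<le> N \<epsilon>" if "0 < \<epsilon>" for \<epsilon>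
    using lower[OF that] r that by (meson order_trans zero_le_power divide_nonneg_nonneg less_imp_le real_sqrt_ge_zero mult_nonneg_nonneg zero_le_numeral)
  have "eventually (\<lambda>\<epsilon>. norm (N \<epsilon>) \<le> (3 * r' / sqrt 2) ^ d * norm (\<epsilon> powr (- (real d / 2)))) (at_right 0)"
    unfolding eventually_at_right_field
  proof (intro exI conjI allI impI)
    \<comment> \<open>At this threshold \<open>sqrt (2 * \<epsilon>)\<close> equals
      \<open>r'\<close>.\<close>
    show "0 < r'\<^sup>2 / 2" using r by simp
    fix \<epsilon> :: real assume \<epsilon>: "0 < \<epsilon>" "\<epsilon> < r'\<^sup>2 / 2"
    then have "sqrt (2 * \<epsilon>) \<le> r'"
      using r by (intro real_le_lsqrt) auto
    then have "1 \<le> r' / sqrt (2 * \<epsilon>)"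
      using \<epsilon> by simp
    then have "1 + 2 * r' / sqrt (2 * \<epsilon>) \<le> 3 * r' / sqrt (2 * \<epsilon>)"
      by linarith
    then have "(1 + 2 * r' / sqrt (2 * \<epsilon>)) ^ d \<le> (3 * r' / sqrt (2 * \<epsilon>)) ^ d"
      using r \<epsilon> by (intro power_mono) auto
    then show "norm (N \<epsilon>) \<le> (3 * r' / sqrt 2) ^ d * norm (\<epsilon> powr (- (real d / 2)))"
      using upper[OF \<epsilon>(1)] nonneg[OF \<epsilon>(1)] power_div_sqrt[OF \<epsilon>(1), of "3 * r'" d] by simp
  qed
  then show "N \<in> O[at_right 0](\<lambda>\<epsilon>. \<epsilon> powr (- (real d / 2)))"
    by (rule bigoI)
  have "eventually (\<lambda>\<epsilon>. norm (N \<epsilon>) \<ge> (r / sqrt 2) ^ d * norm (\<epsilon> powr (- (real d / 2)))) (at_right 0)"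
    using eventually_at_right_less[of 0]
  proof eventually_elim
    case (elim \<epsilon>)
    then show ?case using lower[OF elim] nonneg[OF elim] power_div_sqrt[OF elim, of r d] by simp
  qed
  then show "N \<in> \<Omega>[at_right 0](\<lambda>\<epsilon>. \<epsilon> powr (- (real d / 2)))"
    using r by (intro landau_omega.bigI[of "(r / sqrt 2) ^ d"]) auto
qed

theorem theorem8p2:
  fixes X S :: "(real^'n) set" and B :: "real^'n^'n" and s0 :: "real^'n"
    and d :: nat and r_minus r_plus :: real
  assumes "compact X"
    and "sym_psd B"
    and "rank B = d" and "d > 0"
    and "S = (\<lambda>x. psd_sqrt B *v x) ` X"
    and "s0 \<in> range ((*v) B)"
    and "0 < r_minus" and "r_minus \<le> r_plus"
    and "(\<lambda>u. s0 + r_minus *\<^sub>R u) ` range_unit_ball B \<subseteq> S"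
    and "S \<subseteq> (\<lambda>u. s0 + r_plus *\<^sub>R u) ` range_unit_ball B"
  shows "(\<forall>\<epsilon>>0. \<exists>m. approximable X B \<epsilon> m) \<and>
    (\<forall>\<epsilon>>0. sqrt (2 * \<epsilon>) < r_minus \<longrightarrow>
        (r_minus / sqrt (2 * \<epsilon>)) ^ d \<le> real (min_supports X B \<epsilon>) \<and>
        real (min_supports X B \<epsilon>) \<le> (1 + 2 * r_plus / sqrt (2 * \<epsilon>)) ^ d) \<and>
    (\<lambda>\<epsilon>. real (min_supports X B \<epsilon>)) \<in> \<Theta>[at_right 0](\<lambda>\<epsilon>. \<epsilon> powr (- (real d / 2)))"
proof -
  let ?V = "range ((*v) B)"
  have V: "subspace ?V"
    by (simp add: subspace_UNIV linear_subspace_image)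
  have d: "dim ?V = d" using assms(3) by (simp add: rank_dim_range)
  have rp: "0 < r_plus" using assms(7,8) by simp
  have inner: "cball s0 r_minus \<inter> ?V \<subseteq> S"
    using assms(9) scaled_ball_range[OF assms(7,6)] by simp
  have outer: "S \<subseteq> cball s0 r_plus" "S \<subseteq> ?V"
    using assms(10) scaled_ball_range[OF rp assms(6)] by auto
  \<comment> \<open>The centre of the inner ball witnesses that \<open>S\<close>, and with it
    \<open>X\<close>, is nonempty.\<close>
  have "s0 \<in> S" using inner assms(6,7) by auto
  then have "X \<noteq> {}" using assms(5) by auto
  note iff = approximable_iff_covering[OF assms(1) this assms(2), folded assms(5)]
  have bounds: "(\<exists>m. approximable X B \<epsilon> m) \<and>
      (r_minus / sqrt (2 * \<epsilon>)) ^ d \<le> real (min_supports X B \<epsilon>) \<and>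
      real (min_supports X B \<epsilon>) \<le> (1 + 2 * r_plus / sqrt (2 * \<epsilon>)) ^ d" if \<epsilon>: "0 < \<epsilon>" for \<epsilon>
  proof -
    have \<delta>: "0 < sqrt (2 * \<epsilon>)" using \<epsilon> by simp
    obtain C where C: "finite C" "C \<subseteq> S" "S \<subseteq> (\<Union>p\<in>C. cball p (sqrt (2 * \<epsilon>)))"
      "card C \<le> (1 + 2 * r_plus / sqrt (2 * \<epsilon>)) ^ d"
      using covering_number_upper[OF V outer(2) assms(6) rp \<delta> outer(1)] unfolding d by blast
    have ex: "approximable X B \<epsilon> (card C)"
      using C \<epsilon> by (subst iff) auto
    then have le: "min_supports X B \<epsilon> \<le> card C"
      unfolding min_supports_def by (rule Least_le)
    \<comment> \<open>The minimum is attained, so it also yields a covering \<open>D\<close>. Volume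
      bounds \<open>card D\<close> from below, while \<open>card C\<close> bounds the minimum from
      above.\<close>
    have "approximable X B \<epsilon> (min_supports X B \<epsilon>)"
      unfolding min_supports_def using ex by (rule LeastI)
    then obtain D where D: "finite D" "D \<subseteq> S" "card D \<le> min_supports X B \<epsilon>"
      "S \<subseteq> (\<Union>p\<in>D. cball p (sqrt (2 * \<epsilon>)))"
      using \<epsilon> iff[of \<epsilon>] by auto
    have "(r_minus / sqrt (2 * \<epsilon>)) ^ d \<le> card D"
      using covering_number_lower[OF V _ assms(6) D(1) assms(7) \<delta>] D(2,4) inner outer(2) d by blast
    then show ?thesis using ex le C(4) D(3) by force
  qed
  moreover have "(\<lambda>\<epsilon>. real (min_supports X B \<epsilon>)) \<in> \<Theta>[at_right 0](\<lambda>\<epsilon>. \<epsilon> powr (- (real d / 2)))"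
    by (rule theta_of_covering_bounds[OF assms(7) rp]) (use bounds in auto)
  ultimately show ?thesis by blast
qed

end
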